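(* The essential height of an $l$-generated PI-algebra satisfying an admissible polynomial identity of degree $n$, over the set of words (in the generators) of length $<n$, is less than $$\Upsilon(n,l)=8(l+1)^n n^6 l.$$
   Context: Algebras are associative. An admissible polynomial identity of degree $n$ is, in the usual sense of Shirshov, a polynomial identity of degree $n$ in which some monomial of highest degree has coefficient $1$. Words are monomials in the $l$ generators. Essential height: an algebra $A$ has essential height $h$ over a finite set $Y\subset A$ if one can choose a finite set $D\subset A$ such that $A$ is linearly spanned by elements of the form $t_1t_2\cdots t_s$ with $s\le 2h+1$, where for each $i$ either $t_i\in D$ or $t_i=y_i^{k_i}$ with $y_i\in Y$, and the set of indices $i$ with $t_i\notin D$ has at most $h$ elements; the essential height is the least such $h$. *)

theory Defs
  imports "HOL-Library.Poly_Mapping" "HOL-Library.Extended_Nat"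
begin

text \<open>Algebras are associative over a commutative ring with 1; they need not be unital
  themselves, so that products are only formed of nonempty lists of factors.\<close>

fun lprod :: "'a::ring list \<Rightarrow> 'a" where
  "lprod [] = 0"  \<comment> \<open>junk value, excluded wherever \<open>lprod\<close> is used below\<close>
| "lprod [x] = x"
| "lprod (x # y # zs) = x * lprod (y # zs)"

text \<open>The power \<open>x\<^sup>k\<close>, for \<open>k \<ge> 1\<close> (there may be no unit).\<close>

definition pos_power :: "'a::ring \<Rightarrow> nat \<Rightarrow> 'a" where
  "pos_power x k = lprod (replicate k x)"

text \<open>Values in \<open>A\<close> of the nonempty words of length less than \<open>n\<close>
  in the generators \<open>a 0, \<dots>, a (l - 1)\<close>.\<close>

definition words_below :: "(nat \<Rightarrow> 'a::ring) \<Rightarrow> nat \<Rightarrow> nat \<Rightarrow> 'a set" where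
  "words_below a l n = {lprod (map a w) | w. w \<noteq> [] \<and> set w \<subseteq> {..<l} \<and> length w < n}"

text \<open>An element of the free associative algebra over \<open>'k\<close> on countably many variables is a
  finitely supported function from words (\<open>nat list\<close>) to coefficients.\<close>

type_synonym 'k nc_poly = "nat list \<Rightarrow>\<^sub>0 'k"

definition nc_degree :: "'k::zero nc_poly \<Rightarrow> nat" where
  "nc_degree f = Max (length ` Poly_Mapping.keys f)"

locale assoc_algebra = module scale
  for scale :: "'k::comm_ring_1 \<Rightarrow> 'a::ring \<Rightarrow> 'a" +
  assumes scale_mult_left: "scale c (x * y) = scale c x * y"
    and scale_mult_right: "scale c (x * y) = x * scale c y"
begin

definition subalgebra :: "'a set \<Rightarrow> bool" where
  "subalgebra B \<longleftrightarrow> subspace B \<and> (\<forall>x\<in>B. \<forall>y\<in>B. x * y \<in> B)"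

text \<open>If \<open>A\<close> has an identity element, it is available for free; this covers generation
  both of unital and of not necessarily unital algebras.\<close>

definition generated_by :: "'a set \<Rightarrow> bool" where
  "generated_by S \<longleftrightarrow>
     subalgebra hull (S \<union> {e. \<forall>x. e * x = x \<and> x * e = x}) = UNIV"

definition nc_eval :: "'k nc_poly \<Rightarrow> (nat \<Rightarrow> 'a) \<Rightarrow> 'a" where
  "nc_eval f x =
     (\<Sum>w\<in>Poly_Mapping.keys f. scale (Poly_Mapping.lookup f w) (lprod (map x w)))"

text \<open>Polynomial identities have no constant term, as \<open>A\<close> may have no unit.\<close>

definition polynomial_identity :: "'k nc_poly \<Rightarrow> bool" where
  "polynomial_identity f \<longleftrightarrow> [] \<notin> Poly_Mapping.keys f \<and> (\<forall>x. nc_eval f x = 0)"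

definition admissible_identity :: "'k nc_poly \<Rightarrow> nat \<Rightarrow> bool" where
  "admissible_identity f n \<longleftrightarrow>
     polynomial_identity f \<and> nc_degree f = n \<and>
     (\<exists>w. length w = n \<and> Poly_Mapping.lookup f w = 1)"

definition essentially_spanned :: "'a set \<Rightarrow> nat \<Rightarrow> bool" where
  "essentially_spanned Y h \<longleftrightarrow>
     (\<exists>D. finite D \<and>
        span {lprod ts | ts.
                ts \<noteq> [] \<and> length ts \<le> 2 * h + 1 \<and>
                (\<forall>t\<in>set ts. t \<in> D \<or> (\<exists>y\<in>Y. \<exists>k\<ge>1. t = pos_power y k)) \<and>
                card {i. i < length ts \<and> ts ! i \<notin> D} \<le> h} = UNIV)"

text \<open>The least such \<open>h\<close>, and \<open>\<infinity>\<close> if there is none.\<close>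

definition essential_height :: "'a set \<Rightarrow> enat" where
  "essential_height Y = (INF h\<in>{h. essentially_spanned Y h}. enat h)"

end

definition Upsilon :: "nat \<Rightarrow> nat \<Rightarrow> nat" where
  "Upsilon n l = 8 * (l + 1) ^ n * n ^ 6 * l"

end

theory Submission
  imports Defs "HOL-Library.Multiset" "HOL-Library.Sublist"
    "HOL-Library.List_Lexorder"
begin

text \<open>
  A word with \<open>n\<close> consecutive factors, each lexicographically above the next with the
  comparison decided at a letter inside both, is a combination of smaller words by the
  linearised identity; hence the words without such factors span.
  In a long word of this kind a power \<open>u\<^sup>n\<close> with \<open>0 < |u| < n\<close> occurs: among many disjoint
  blocks of length \<open>n (n + 1)\<close> some word \<open>z\<close> occurs \<open>n\<close> times; if the first \<open>n\<close> suffixes of \<open>z\<close> are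
  pairwise prefix-incomparable, take the \<open>i\<close>-th largest from the \<open>i\<close>-th occurrence, and otherwise
  \<open>z\<close> has a long factor of period less than \<open>n\<close>.
  Splitting greedily, the word consists of long powers \<open>u\<^sup>k\<close> separated by words of bounded length.
  Of the powers of one \<open>u\<close> whose continuation deviates from \<open>u\<^sup>\<infinity>\<close> upwards (or downwards) there are
  fewer than \<open>n\<close>: otherwise the final segments \<open>u\<^sup>j p c\<close>, with \<open>j\<close> increasing (decreasing) from one
  occurrence to the next, would descend lexicographically.
  So the number of powers is at most \<open>2 (n - 1)\<close> times the number of words of length less than \<open>n\<close>,
  plus one; the length of the separating words only affects the finite set \<open>D\<close>.
\<close>

section \<open>Divisible words\<close>

text \<open>Stronger than the lexicographic order: neither word is a prefix of the other, so the
  comparison survives appending anything on the right.\<close>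

definition strictly_above :: "'b::linorder list \<Rightarrow> 'b list \<Rightarrow> bool" where
  "strictly_above x y \<longleftrightarrow> (\<exists>p c d x' y'. x = p @ c # x' \<and> y = p @ d # y' \<and> d < c)"

text \<open>A form of Shirshov's n-divisibility: every nontrivial permutation of the factors in
  \<open>ws\<close> makes the word lexicographically smaller.\<close>

definition divisible :: "nat \<Rightarrow> 'b::linorder list \<Rightarrow> bool" where
  "divisible n w \<longleftrightarrow>
     (\<exists>p ws s. w = p @ concat ws @ s \<and> length ws = n \<and> sorted_wrt strictly_above ws)"

abbreviation wpow :: "'b list \<Rightarrow> nat \<Rightarrow> 'b list" where
  "wpow u k \<equiv> concat (replicate k u)"

lemma strictly_above_append:
  "strictly_above x y \<Longrightarrow> strictly_above (x @ r) (y @ s)"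
  unfolding strictly_above_def by fastforce

lemma strictly_above_nonempty: "strictly_above x y \<Longrightarrow> x \<noteq> [] \<and> y \<noteq> []"
  unfolding strictly_above_def by auto

lemma strictly_above_if_greater:
  fixes x y :: "'b::linorder list"
  assumes "y < x" "\<not> prefix y x"
  shows "strictly_above x y"
proof -
  from assms(1) have "(y, x) \<in> lexord {(u, v). u < v}"
    by (simp add: list_less_def)
  then have "(\<exists>b v. x = y @ b # v) \<or>
      (\<exists>u c d v w. c < d \<and> y = u @ c # v \<and> x = u @ d # w)"
    unfolding lexord_def by blast
  with assms(2) show ?thesis
    unfolding strictly_above_def by (metis prefixI)
qed

lemma divisible_sublist:
  assumes "divisible n v" "sublist v w"
  shows "divisible n w"
proof -
  obtain p ws s where *: "v = p @ concat ws @ s" "length ws = n" "sorted_wrt strictly_above ws"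
    using assms(1) unfolding divisible_def by blast
  obtain p' s' where "w = p' @ v @ s'" using assms(2) unfolding sublist_def by blast
  then have "w = (p' @ p) @ concat ws @ (s @ s')" using * by simp
  with * show ?thesis unfolding divisible_def by blast
qed

text \<open>Extending each chosen factor up to the start of the next one makes the factors
  consecutive. The last one swallows the rest of the word, including \<open>t\<close>; only when
  there are no factors is \<open>t\<close> left over, hence the conditional.\<close>

lemma concat_subseq_split:
  assumes "subseq bs bs'" "list_all2 sublist zs bs"
  shows "\<exists>p ws. concat bs' @ t = p @ concat ws @ (if zs = [] then t else []) \<and> list_all2 prefix zs ws"
  using assms
proof (induction arbitrary: zs rule: list_emb.induct)
  case (list_emb_Nil ys)
  then show ?case by (auto intro!: exI[of _ "concat ys"])
next
  case (list_emb_Cons xs ys y)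
  obtain p ws where "concat ys @ t = p @ concat ws @ (if zs = [] then t else [])"
      "list_all2 prefix zs ws"
    using list_emb_Cons by blast
  then show ?case
    by (intro exI[of _ "y @ p"] exI[of _ ws]) auto
next
  case (list_emb_Cons2 x y xs ys)
  obtain z zs' where zs: "zs = z # zs'" "sublist z x" "list_all2 sublist zs' xs"
    using list_emb_Cons2.prems by (auto simp: list_all2_Cons2)
  obtain p ws where *: "concat ys @ t = p @ concat ws @ (if zs' = [] then t else [])"
      "list_all2 prefix zs' ws"
    using list_emb_Cons2.IH zs(3) by blast
  obtain r s where x: "x = r @ z @ s" using zs(2) unfolding sublist_def by blast
  show ?case
  proof (cases "zs' = []")
    case True
    then show ?thesis using x zs list_emb_Cons2.hyps(1)
      by (intro exI[of _ r] exI[of _ "[z @ s @ concat ys @ t]"]) auto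
  next
    case False
    then show ?thesis using x zs * list_emb_Cons2.hyps(1)
      by (intro exI[of _ r] exI[of _ "(z @ s @ p) # ws"]) auto
  qed
qed

text \<open>The way divisibility is established below: descending factors need only lie in different
  blocks, since stretching them to the right keeps them descending.\<close>

lemma divisible_concat:
  assumes "subseq bs bs'" "list_all2 sublist zs bs" "sorted_wrt strictly_above zs"
  shows "divisible (length zs) (concat bs' @ t)"
proof -
  obtain p ws where *: "concat bs' @ t = p @ concat ws @ (if zs = [] then t else [])"
      "list_all2 prefix zs ws"
    using concat_subseq_split[OF assms(1,2)] by blast
  have len: "length ws = length zs" using *(2) by (simp add: list_all2_lengthD)
  have "sorted_wrt strictly_above ws"
    unfolding sorted_wrt_iff_nth_less
  proof (intro allI impI)
    fix i j assume ij: "i < j" "j < length ws"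
    have "strictly_above (zs ! i) (zs ! j)"
      using assms(3) ij len by (simp add: sorted_wrt_iff_nth_less)
    moreover have "prefix (zs ! i) (ws ! i)" "prefix (zs ! j) (ws ! j)"
      using *(2) ij len by (auto simp: list_all2_conv_all_nth)
    ultimately show "strictly_above (ws ! i) (ws ! j)"
      by (metis prefixE strictly_above_append)
  qed
  with *(1) len show ?thesis unfolding divisible_def by metis
qed

lemma list_pigeonhole:
  assumes "finite S" "f ` set xs \<subseteq> S" "card S * m < length xs"
  shows "\<exists>s\<in>S. m < length (filter (\<lambda>x. f x = s) xs)"
proof (rule ccontr)
  assume "\<not> ?thesis"
  then have le: "length (filter (\<lambda>x. f x = s) xs) \<le> m" if "s \<in> S" for s
    using that by auto
  have cl: "count_list (map f xs) s = length (filter (\<lambda>x. f x = s) xs)" for s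
    by (induction xs) auto
  have "length xs = sum (count_list (map f xs)) (set (map f xs))"
    by (simp add: sum_count_set del: count_list_map_conv set_map)
  also have "\<dots> \<le> sum (count_list (map f xs)) S"
    using assms(1,2) by (intro sum_mono2) auto
  also have "\<dots> \<le> (\<Sum>s\<in>S. m)"
    using le cl by (intro sum_mono) simp
  also have "\<dots> = card S * m" by simp
  finally show False using assms(3) by simp
qed

section \<open>Powers in long indivisible words\<close>

text \<open>The first assumption says that \<open>r\<close> has period \<open>length t\<close>;
  removing one copy of \<open>t\<close> from the front preserves it.\<close>

lemma prefix_period:
  assumes "prefix r (t @ r)" "m * length t \<le> length r"
  shows "prefix (wpow t m) r"
  using assms
proof (induction m arbitrary: r)
  case (Suc m)
  have "prefix t r"
    using Suc.prems by (metis le_add1 mult_Suc order_trans prefixI prefix_length_prefix)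
  then obtain r' where r: "r = t @ r'" by (auto elim: prefixE)
  with Suc show ?case by auto
qed simp

lemma split_blocks:
  assumes "m * L \<le> length w"
  shows "\<exists>bs t. w = concat bs @ t \<and> length bs = m \<and> (\<forall>b\<in>set bs. length b = L)"
  using assms
proof (induction m arbitrary: w)
  case (Suc m)
  have "m * L \<le> length (drop L w)" using Suc.prems by simp
  then obtain bs t where "drop L w = concat bs @ t \<and> length bs = m \<and> (\<forall>b\<in>set bs. length b = L)"
    using Suc.IH by blast
  then show ?case using Suc.prems
    by (intro exI[of _ "take L w # bs"] exI[of _ t])
      (auto, metis append_take_drop_id)
qed simp

text \<open>Blocks of length \<open>Suc n * n\<close>, as many as there are words of that length
  over \<open>l\<close> letters, times \<open>n\<close>: some word then fills \<open>n\<close>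
  blocks.\<close>

definition power_bound :: "nat \<Rightarrow> nat \<Rightarrow> nat" where
  "power_bound n l = l ^ (Suc n * n) * n * (Suc n * n)"

text \<open>The candidates are the suffixes starting at the first \<open>n\<close> positions. Two
  that are prefix-comparable would force a period below \<open>n\<close> on a long stretch;
  otherwise sorting them gives the chain.\<close>

lemma suffixes_or_power:
  fixes z :: "'b::linorder list"
  assumes "length z = Suc n * n" "n \<ge> 1"
    and nopow: "\<not> (\<exists>u. u \<noteq> [] \<and> length u < n \<and> sublist (wpow u n) z)"
  shows "\<exists>zs. length zs = n \<and> sorted_wrt strictly_above zs \<and> (\<forall>y\<in>set zs. sublist y z)"
proof -
  have incomp: "\<not> prefix (drop j z) (drop i z)" if "i < j" "j < n" for i j
  proof
    assume pre: "prefix (drop j z) (drop i z)"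
    \<comment> \<open>The shift between the two suffixes is a period of the longer one.\<close>
    define t where "t = take (j - i) (drop i z)"
    have split: "drop i z = t @ drop j z"
      using that unfolding t_def by (metis append_take_drop_id drop_drop le_add_diff_inverse2 less_imp_le)
    have len: "length t = j - i" using that assms unfolding t_def by simp
    have "n * length t \<le> n * n" using that len by (intro mult_le_mono2) linarith
    \<comment> \<open>The extra \<open>n\<close> letters in the length of \<open>z\<close>
      compensate for the \<open>j < n\<close> dropped ones.\<close>
    also have "\<dots> \<le> length (drop j z)" using that assms by simp
    finally have "prefix (wpow t n) (drop j z)"
      using pre split by (intro prefix_period) auto
    then have "sublist (wpow t n) z"
      by (meson prefix_imp_sublist sublist_drop sublist_order.order.trans)
    moreover have "t \<noteq> []" "length t < n" using len that by auto
    ultimately show False using nopow by blast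
  qed
  define F where "F = (\<lambda>i. drop i z) ` {..<n}"
  have "n \<le> length z" using assms by simp
  then have inj: "inj_on (\<lambda>i. drop i z) {..<n}"
    by (intro inj_onI) (metis diff_diff_cancel length_drop lessThan_iff less_imp_le order_trans)
  define zs where "zs = rev (sorted_list_of_set F)"
  have fin: "finite F" unfolding F_def by simp
  have set: "set zs = F" using fin unfolding zs_def by simp
  have len: "length zs = n" using inj unfolding zs_def F_def by (simp add: card_image)
  have "sorted_wrt (<) (sorted_list_of_set F)" by simp
  then have gt: "sorted_wrt (\<lambda>x y. y < x) zs" unfolding zs_def by (simp add: sorted_wrt_rev)
  have "sorted_wrt strictly_above zs"
  proof (rule sorted_wrt_mono_rel[OF _ gt])
    fix x y assume xy: "x \<in> set zs" "y \<in> set zs" "y < x"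
    then obtain i j where ij: "x = drop i z" "y = drop j z" "i < n" "j < n"
      unfolding set F_def by auto
    have "\<not> prefix y x"
    proof (cases "i < j")
      case True then show ?thesis using incomp ij by auto
    next
      case False
      then have "j < i" using ij xy by (metis less_irrefl linorder_neqE_nat)
      then have "length x < length y" using ij \<open>n \<le> length z\<close> by simp
      then show ?thesis using prefix_length_le by fastforce
    qed
    then show "strictly_above x y" using xy(3) by (rule strictly_above_if_greater[rotated])
  qed
  moreover have "\<forall>y\<in>set zs. sublist y z" unfolding set F_def by auto
  ultimately show ?thesis using len by blast
qed

lemma power_in_long_indivisible_word:
  assumes w: "set w \<subseteq> {..<l}" "power_bound n l \<le> length w"
    and n: "n \<ge> 1" and l: "l \<ge> 1" and indiv: "\<not> divisible n w"
  shows "\<exists>u. u \<noteq> [] \<and> length u < n \<and> sublist (wpow u n) w"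
proof (rule ccontr)
  assume nopow: "\<not> ?thesis"
  define L where "L = Suc n * n"
  obtain bs t where bs: "w = concat bs @ t" "length bs = l ^ L * n" "\<forall>b\<in>set bs. length b = L"
    using split_blocks[of "l ^ L * n" L w] w(2) unfolding power_bound_def L_def by blast
  define S where "S = {z. set z \<subseteq> {..<l} \<and> length z = L}"
  have S: "finite S" "card S = l ^ L"
    unfolding S_def by (auto simp: finite_lists_length_eq card_lists_length_eq)
  have sub: "id ` set bs \<subseteq> S" using w(1) bs unfolding S_def by auto
  \<comment> \<open>Strict because \<open>l >= 1\<close> makes \<open>card S\<close>
    positive.\<close>
  have "card S * (n - 1) < length bs" using S n l bs by simp
  from list_pigeonhole[OF S(1) sub this] obtain z
    where z: "z \<in> S" "n - 1 < length (filter (\<lambda>x. id x = z) bs)" by blast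
  define zn where "zn = take n (filter (\<lambda>x. id x = z) bs)"
  have zn: "length zn = n" "subseq zn bs" "\<forall>b\<in>set zn. b = z"
    using z(2) unfolding zn_def
    by (auto dest: in_set_takeD intro: subseq_order.trans[OF prefix_imp_subseq[OF take_is_prefix]])
  have "z \<in> set bs" using z(2) by (metis (mono_tags, lifting) filter_False id_apply length_0_conv less_nat_zero_code list.size(3))
  then have "sublist z w" unfolding bs(1) by (metis append.assoc concat.simps(2) concat_append in_set_conv_decomp sublist_appendI)
  then obtain zs where zs: "length zs = n" "sorted_wrt strictly_above zs" "\<forall>y\<in>set zs. sublist y z"
    using suffixes_or_power[of z n] n z(1) nopow sublist_order.order.trans
    unfolding S_def L_def by blast
  \<comment> \<open>All blocks in \<open>zn\<close> equal \<open>z\<close>, so the i-th member of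
    the chain can be taken from the i-th occurrence.\<close>
  have "list_all2 sublist zs zn" using zs zn unfolding list_all2_conv_all_nth by (metis nth_mem)
  from divisible_concat[OF zn(2) this zs(2)] show False using indiv zs(1) bs(1) by simp
qed

section \<open>Splitting an indivisible word into long powers\<close>

lemma strip_power:
  assumes "u \<noteq> []"
  shows "\<exists>m s. r = wpow u m @ s \<and> \<not> prefix u s"
proof (induction r rule: length_induct)
  case (1 r)
  show ?case
  proof (cases "prefix u r")
    case True
    then obtain r' where r: "r = u @ r'" by (auto elim: prefixE)
    then have "length r' < length r" using assms by simp
    with 1 obtain m s where "r' = wpow u m @ s" "\<not> prefix u s" by blast
    then show ?thesis using r by (intro exI[of _ "Suc m"] exI[of _ s]) auto
  next
    case False
    then show ?thesis by (intro exI[of _ 0] exI[of _ r]) auto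
  qed
qed

text \<open>A block \<open>d u\<^sup>k p c\<close> runs up to the first letter \<open>c\<close> at which the word stops
  following \<open>u\<^sup>\<infinity>\<close>; the periodic continuation would have been \<open>c'\<close>.\<close>

datatype block =
  Block (lead: "nat list") (base: "nat list") (expo: nat) (rem: "nat list") (dev: nat)

definition block_word :: "block \<Rightarrow> nat list" where
  "block_word b = lead b @ wpow (base b) (expo b) @ rem b @ [dev b]"

text \<open>Exponent at least \<open>n\<close> leaves room for the final segments
  \<open>u^j p c\<close> with every \<open>j < n\<close>. The last conjunct also makes the base
  nonempty.\<close>

definition block_ok :: "nat \<Rightarrow> nat \<Rightarrow> block \<Rightarrow> bool" where
  "block_ok n N b \<longleftrightarrow> length (lead b) \<le> N \<and> length (base b) < n \<and> n \<le> expo b \<and>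
     (\<exists>c' q. base b = rem b @ c' # q \<and> c' \<noteq> dev b)"

text \<open>What remains when no further block closes: a short word, or a power whose period is
  still being followed when the word ends.\<close>

definition tail_ok :: "nat \<Rightarrow> nat \<Rightarrow> nat list \<Rightarrow> bool" where
  "tail_ok n N t \<longleftrightarrow> length t \<le> N \<or>
     (\<exists>d u k p. t = d @ wpow u k @ p \<and> length d \<le> N \<and> u \<noteq> [] \<and> length u < n \<and> 1 \<le> k \<and> length p < n)"

text \<open>The power is sought among the first \<open>power_bound n l\<close> letters only, which
  bounds the lead. It is then prolonged as far as possible; if the rest \<open>s\<close> is not a
  prefix of \<open>u\<close>, the first letter where they differ closes the block, and the induction
  continues behind it.\<close>

lemma block_decomposition:
  assumes "n \<ge> 1" "l \<ge> 1" "set w \<subseteq> {..<l}" "\<not> divisible n w"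
  shows "\<exists>bs t. w = concat (map block_word bs) @ t \<and>
    (\<forall>b\<in>set bs. block_ok n (power_bound n l) b) \<and> tail_ok n (power_bound n l) t"
  using assms(3,4)
proof (induction w rule: length_induct)
  case (1 w)
  let ?N = "power_bound n l"
  show ?case
  proof (cases "length w < ?N")
    case True
    then show ?thesis by (intro exI[of _ "[]"] exI[of _ w]) (simp add: tail_ok_def)
  next
    case False
    have "set (take ?N w) \<subseteq> {..<l}" using 1 by (meson order_trans set_take_subset)
    moreover have "\<not> divisible n (take ?N w)" using 1 divisible_sublist sublist_take by blast
    ultimately obtain u where u: "u \<noteq> []" "length u < n" "sublist (wpow u n) (take ?N w)"
      using power_in_long_indivisible_word[of "take ?N w" l n] assms(1,2) False by auto
    then obtain d r where dr: "take ?N w = d @ wpow u n @ r" unfolding sublist_def by blast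
    obtain m s where s: "r @ drop ?N w = wpow u m @ s" "\<not> prefix u s"
      using strip_power[OF u(1)] by blast
    have "w = take ?N w @ drop ?N w" by simp
    also have "\<dots> = d @ wpow u n @ (r @ drop ?N w)" unfolding dr by simp
    also have "\<dots> = d @ wpow u (n + m) @ s" unfolding s(1) by (simp add: replicate_add)
    finally have w: "w = d @ wpow u (n + m) @ s" .
    have d: "length d \<le> ?N" using arg_cong[OF dr, of length] by simp
    show ?thesis
    proof (cases "prefix s u")
      case True
      then have "length s < n" using u(2) prefix_length_le by fastforce
      then have "tail_ok n ?N w" using w d u assms(1) unfolding tail_ok_def
        by (metis le_add1 order_trans)
      then show ?thesis by (intro exI[of _ "[]"] exI[of _ w]) simp
    next
      case False
      then have "parallel u s" using s(2) by auto
      then obtain p c' q c v where par: "c' \<noteq> c" "u = p @ c' # q" "s = p @ c # v"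
        using parallel_decomp by blast
      define b where "b = Block d u (n + m) p c"
      have wb: "w = block_word b @ v" unfolding w b_def block_word_def par(3) by simp
      have "length v < length w" unfolding wb by (simp add: block_word_def)
      moreover have "set v \<subseteq> {..<l}" using 1(2) wb by simp
      moreover have "\<not> divisible n v"
        using 1(3) divisible_sublist[of n v w] unfolding wb by auto
      ultimately obtain bs t where "v = concat (map block_word bs) @ t"
        "\<forall>b\<in>set bs. block_ok n ?N b" "tail_ok n ?N t"
        using 1(1) by blast
      moreover have "block_ok n ?N b" using d u par unfolding b_def block_ok_def by auto
      ultimately show ?thesis using wb
        by (intro exI[of _ "b # bs"] exI[of _ t]) auto
    qed
  qed
qed


section \<open>Counting the blocks of an indivisible word\<close>

lemma wpow_split:
  assumes "i < j"
  shows "wpow u j = wpow u i @ u @ wpow u (j - i - 1)"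
proof -
  have "j = i + Suc (j - i - 1)" using assms by simp
  then have "wpow u j = wpow u (i + Suc (j - i - 1))" by (rule arg_cong)
  then show ?thesis by (simp only: replicate_add replicate_Suc concat_append concat.simps)
qed

text \<open>After \<open>u^i p\<close> the longer power still follows the period and reads
  \<open>c'\<close> where the shorter one reads \<open>c\<close>. So with an upward deviation the
  smaller exponent is on top; the next lemma is the mirror image.\<close>

lemma deviation_above:
  assumes "u = p @ c' # q" "c' < c" "i < j"
  shows "strictly_above (wpow u i @ p @ [c]) (wpow u j @ r)"
proof -
  have "wpow u j = wpow u i @ u @ wpow u (j - i - 1)"
    using wpow_split[OF assms(3)] .
  also have "\<dots> = (wpow u i @ p) @ c' # q @ wpow u (j - i - 1)" using assms(1) by simp
  finally show ?thesis using assms(2) unfolding strictly_above_def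
    by (metis append.assoc append_Cons)
qed

lemma deviation_below:
  assumes "u = p @ c' # q" "c < c'" "i < j"
  shows "strictly_above (wpow u j @ r) (wpow u i @ p @ [c])"
proof -
  have "wpow u j = wpow u i @ u @ wpow u (j - i - 1)"
    using wpow_split[OF assms(3)] .
  also have "\<dots> = (wpow u i @ p) @ c' # q @ wpow u (j - i - 1)" using assms(1) by simp
  finally show ?thesis using assms(2) unfolding strictly_above_def
    by (metis append.assoc append_Cons)
qed

text \<open>The letter on the left is the one that the periodic continuation would have had.\<close>

definition deviates_up :: "block \<Rightarrow> bool" where
  "deviates_up b \<longleftrightarrow> base b ! length (rem b) < dev b"

text \<open>Each block ends in \<open>u^j p c\<close> for every \<open>j < n\<close>, so the
  exponent can be chosen freely in each of the \<open>n\<close> blocks to produce a descending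
  chain.\<close>

lemma same_deviation_divisible:
  assumes ok: "\<forall>b\<in>set bs. block_ok n N b \<and> base b = u \<and> deviates_up b = up"
    and "length bs = n" "subseq bs bs'"
  shows "divisible n (concat (map block_word bs') @ t)"
proof -
  \<comment> \<open>Upward deviations need rising exponents, downward ones falling exponents; both
    choices stay below \<open>n\<close>.\<close>
  define e where "e i = (if up then i else n - 1 - i)" for i
  define z where "z i = wpow u (e i) @ rem (bs ! i) @ [dev (bs ! i)]" for i
  have b: "\<exists>c' q. u = rem (bs ! i) @ c' # q \<and> (if up then c' < dev (bs ! i) else dev (bs ! i) < c')"
    if "i < n" for i
  proof -
    have "bs ! i \<in> set bs" using that assms(2) by simp
    with ok have *: "block_ok n N (bs ! i)" "base (bs ! i) = u" "deviates_up (bs ! i) = up" by auto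
    then obtain c' q where cq: "u = rem (bs ! i) @ c' # q" "c' \<noteq> dev (bs ! i)"
      unfolding block_ok_def by auto
    have "up \<longleftrightarrow> c' < dev (bs ! i)" using * cq(1) unfolding deviates_up_def
      by (metis nth_append_length)
    then show ?thesis using cq by (metis linorder_neqE_nat)
  qed
  have sub: "sublist (z i) (block_word (bs ! i))" if "i < n" for i
  proof -
    have "bs ! i \<in> set bs" using that assms(2) by simp
    with ok have *: "n \<le> expo (bs ! i)" "base (bs ! i) = u" unfolding block_ok_def by auto
    have "e i \<le> expo (bs ! i)" using that * unfolding e_def by auto
    then have "wpow u (expo (bs ! i)) = wpow u (expo (bs ! i) - e i) @ wpow u (e i)"
      by (metis concat_append le_add_diff_inverse2 replicate_add)
    then have "block_word (bs ! i) = (lead (bs ! i) @ wpow u (expo (bs ! i) - e i)) @ z i"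
      unfolding block_word_def z_def *(2) by simp
    then show ?thesis by (metis sublist_append_leftI)
  qed
  have above: "strictly_above (z i) (z j)" if ij: "i < j" "j < n" for i j
  proof (cases up)
    case True
    obtain c' q where "u = rem (bs ! i) @ c' # q" "c' < dev (bs ! i)"
      using b[of i] True ij by auto
    from deviation_above[OF this ij(1)] show ?thesis
      unfolding z_def e_def using True by simp
  next
    case False
    obtain c' q where *: "u = rem (bs ! j) @ c' # q" "dev (bs ! j) < c'"
      using b[of j] False ij by auto
    have "n - 1 - j < n - 1 - i" using ij by linarith
    from deviation_below[OF * this] show ?thesis
      unfolding z_def e_def using False by simp
  qed
  have "sorted_wrt strictly_above (map z [0..<n])"
    using above by (simp add: sorted_wrt_iff_nth_less)
  moreover have "list_all2 sublist (map z [0..<n]) (map block_word bs)"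
    using sub assms(2) by (simp add: list_all2_conv_all_nth)
  ultimately show ?thesis
    using divisible_concat[OF subseq_map[OF assms(3), of block_word], of "map z [0..<n]" t] by simp
qed

lemma sum_powers_le: "(\<Sum>i\<le>m. l ^ i) \<le> (l + 1 :: nat) ^ m"
proof (induction m)
  case (Suc m)
  have "l * l ^ m \<le> l * (l + 1) ^ m" by (intro mult_le_mono2 power_mono) auto
  with Suc have "(\<Sum>i\<le>m. l ^ i) + l * l ^ m \<le> (l + 1) ^ m + l * (l + 1) ^ m"
    by (rule add_mono[OF _ _])
  then show ?case by simp
qed simp

text \<open>Pigeonhole on the pair of base and direction of deviation: \<open>n\<close> blocks
  sharing both would make the word divisible. The factor 2 counts directions, the power of
  \<open>l + 1\<close> bounds the number of bases, and \<open>n - 1\<close> blocks are allowed per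
  pair.\<close>

lemma block_count:
  assumes ok: "\<forall>b\<in>set bs. block_ok n N b" and n: "n \<ge> 1"
    and letters: "set (concat (map block_word bs)) \<subseteq> {..<l}"
    and indiv: "\<not> divisible n (concat (map block_word bs) @ t)"
  shows "length bs \<le> 2 * (l + 1) ^ (n - 1) * (n - 1)"
proof (rule ccontr)
  assume long: "\<not> ?thesis"
  define S where "S = {u. set u \<subseteq> {..<l} \<and> length u \<le> n - 1} \<times> (UNIV :: bool set)"
  have fin: "finite S" unfolding S_def by (simp add: finite_lists_length_le)
  have "card S = 2 * (\<Sum>i\<le>n - 1. l ^ i)"
    unfolding S_def by (simp add: card_cartesian_product card_lists_length_le)
  then have card: "card S \<le> 2 * (l + 1) ^ (n - 1)" using sum_powers_le by simp
  let ?key = "\<lambda>b. (base b, deviates_up b)"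
  have "set (base b) \<subseteq> {..<l}" if "b \<in> set bs" for b
  proof -
    \<comment> \<open>The exponent is positive, so the base occurs in the word and uses only its
      letters.\<close>
    have "n \<le> expo b" using ok that unfolding block_ok_def by blast
    then have "set (base b) \<subseteq> set (block_word b)" using n unfolding block_word_def by auto
    also have "\<dots> \<subseteq> {..<l}" using letters that by auto
    finally show ?thesis .
  qed
  then have key: "?key ` set bs \<subseteq> S"
    using ok unfolding S_def block_ok_def by fastforce
  have "card S * (n - 1) \<le> 2 * (l + 1) ^ (n - 1) * (n - 1)" using card by (rule mult_le_mono1)
  also have "\<dots> < length bs" using long by simp
  finally obtain s where s: "n - 1 < length (filter (\<lambda>b. ?key b = s) bs)"
    using list_pigeonhole[OF fin key] by blast
  define bs' where "bs' = take n (filter (\<lambda>b. ?key b = s) bs)"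
  have "length bs' = n" "subseq bs' bs" using s unfolding bs'_def
    by (auto intro: subseq_order.trans[OF prefix_imp_subseq[OF take_is_prefix]])
  moreover have "\<forall>b\<in>set bs'. block_ok n N b \<and> base b = fst s \<and> deviates_up b = snd s"
    using ok unfolding bs'_def by (auto dest!: in_set_takeD)
  ultimately show False using same_deviation_divisible indiv by blast
qed

text \<open>Each block is cut into its lead, its power and the deviating end \<open>p c\<close>; the
  tail gives at most three more pieces, whence the factor 3 and the summand 1.\<close>

lemma indivisible_word_pieces:
  assumes "n \<ge> 1" "l \<ge> 1" "set w \<subseteq> {..<l}" "\<not> divisible n w"
  shows "\<exists>ws. w = concat ws \<and> length ws \<le> 3 * (2 * (l + 1) ^ (n - 1) * (n - 1) + 1) \<and>
    (\<forall>v\<in>set ws. length v \<le> power_bound n l + n \<or>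
      (\<exists>u k. v = wpow u k \<and> u \<noteq> [] \<and> length u < n \<and> 1 \<le> k))"
proof -
  let ?N = "power_bound n l"
  let ?good = "\<lambda>v. length v \<le> ?N + n \<or>
      (\<exists>u k. v = wpow u k \<and> u \<noteq> [] \<and> length u < n \<and> 1 \<le> k)"
  obtain bs t where bs: "w = concat (map block_word bs) @ t"
      "\<forall>b\<in>set bs. block_ok n ?N b" "tail_ok n ?N t"
    using block_decomposition[OF assms] by blast
  have len: "length bs \<le> 2 * (l + 1) ^ (n - 1) * (n - 1)"
    using block_count[OF bs(2) assms(1)] bs(1) assms(3,4) by simp
  obtain ts where ts: "t = concat ts" "length ts \<le> 3" "\<forall>v\<in>set ts. ?good v"
  proof (cases "length t \<le> ?N")
    case True
    then show ?thesis by (intro that[of "[t]"]) auto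
  next
    case False
    then obtain d u k p where "t = d @ wpow u k @ p" "length d \<le> ?N" "u \<noteq> []"
        "length u < n" "1 \<le> k" "length p < n"
      using bs(3) unfolding tail_ok_def by blast
    then show ?thesis by (intro that[of "[d, wpow u k, p]"]) auto
  qed
  define P where "P b = [lead b, wpow (base b) (expo b), rem b @ [dev b]]" for b
  have P: "?good v" if "b \<in> set bs" "v \<in> set (P b)" for b v
  proof -
    have ok: "block_ok n ?N b" using bs(2) that(1) by blast
    then have "length (rem b) < n" "base b \<noteq> []" "length (base b) < n" "1 \<le> expo b"
      using assms(1) unfolding block_ok_def by auto
    moreover have "length (lead b) \<le> ?N" using ok unfolding block_ok_def by blast
    ultimately show ?thesis using that(2) unfolding P_def by auto
  qed
  have "w = concat (concat (map P bs) @ ts)"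
  proof -
    have "concat (concat (map P bs)) = concat (map block_word bs)" for bs
      by (induction bs) (simp_all add: P_def block_word_def)
    then show ?thesis using bs(1) ts(1) by simp
  qed
  moreover have "length (concat (map P bs) @ ts) \<le> 3 * (2 * (l + 1) ^ (n - 1) * (n - 1) + 1)"
  proof -
    have "length (concat (map P bs)) = 3 * length bs" for bs
      by (induction bs) (simp_all add: P_def)
    then show ?thesis using len ts(2) by simp
  qed
  moreover have "\<forall>v\<in>set (concat (map P bs) @ ts). ?good v" using P ts(3) by auto
  ultimately show ?thesis by blast
qed


section \<open>Permuting factors of a divisible word\<close>

text \<open>For \<open>n >= 2\<close> every factor is compared with another one and so is nonempty.
  For \<open>n = 1\<close> nothing is compared, and the whole word serves as the factor.\<close>

lemma divisible_nonempty_factors: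
  assumes "divisible n w" "n \<ge> 1" "w \<noteq> []"
  shows "\<exists>p ws s. w = p @ concat ws @ s \<and> length ws = n \<and> sorted_wrt strictly_above ws \<and>
    [] \<notin> set ws"
proof (cases "n = 1")
  case True
  then show ?thesis using assms(3)
    by (intro exI[of _ "[]"] exI[of _ "[w]"]) auto
next
  case False
  obtain p ws s where *: "w = p @ concat ws @ s" "length ws = n" "sorted_wrt strictly_above ws"
    using assms(1) unfolding divisible_def by blast
  have "ws ! i \<noteq> []" if "i < n" for i
  proof (cases "i = 0")
    case True
    then have "strictly_above (ws ! 0) (ws ! 1)"
      using * False assms(2) by (simp add: sorted_wrt_iff_nth_less)
    then show ?thesis using True strictly_above_nonempty by blast
  next
    case False
    then have "strictly_above (ws ! 0) (ws ! i)"
      using * that by (simp add: sorted_wrt_iff_nth_less)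
    then show ?thesis using strictly_above_nonempty by blast
  qed
  then have "[] \<notin> set ws" using *(2) by (metis in_set_conv_nth)
  with * show ?thesis by blast
qed

text \<open>Where \<open>v\<close> first departs from the identity it has some \<open>x\<close> in
  place of a smaller \<open>y\<close>, and \<open>ws ! x\<close> loses to \<open>ws ! y\<close> at a
  letter inside both; whatever follows is irrelevant.\<close>

lemma permuted_factors_smaller:
  fixes ws :: "nat list list"
  assumes "sorted_wrt strictly_above ws" "length ws = n"
    and v: "distinct v" "set v = {..<n}" "v \<noteq> [0..<n]"
  shows "(p @ concat (map ((!) ws) v) @ s, p @ concat ws @ s) \<in> lex less_than"
proof -
  have mset: "mset v = mset [0..<n]"
    using v(1,2)
    by (subst set_eq_iff_mset_eq_distinct[symmetric]) (simp_all add: atLeast0LessThan)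
  have ws: "ws = map ((!) ws) [0..<n]" using assms(2) by (metis map_nth)
  have len_sum: "length (concat (map ((!) ws) x)) = sum_mset (image_mset (\<lambda>i. length (ws ! i)) (mset x))" for x
    by (induction x) auto
  \<comment> \<open>\<open>lex\<close> relates only words of equal length, which permuting the
    factors preserves.\<close>
  have len: "length (concat (map ((!) ws) v)) = length (concat ws)"
    by (subst (2) ws) (simp only: len_sum mset)
  have "length v = length [0..<n]" using mset by (metis size_mset)
  from same_length_different[OF v(3) this] obtain pre x xs y ys
    where d: "x \<noteq> y" "v = pre @ x # xs" "[0..<n] = pre @ y # ys" by auto
  have "x \<in> set [0..<n]" using v(2) d(2) by (metis atLeast_upt in_set_conv_decomp)
  moreover have "x \<notin> set pre" using v(1) d(2) by auto
  ultimately have "x \<in> set ys" using d(1,3) by auto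
  moreover have "sorted_wrt (<) (pre @ y # ys)" unfolding d(3)[symmetric] by (rule sorted_wrt_upt)
  ultimately have "y < x" by (auto simp: sorted_wrt_append)
  moreover have "x < n" using \<open>x \<in> set [0..<n]\<close> by simp
  ultimately have "strictly_above (ws ! y) (ws ! x)"
    using assms(1,2) by (simp add: sorted_wrt_iff_nth_less)
  then obtain r c c' x' y' where r: "ws ! y = r @ c # x'" "ws ! x = r @ c' # y'" "c' < c"
    unfolding strictly_above_def by blast
  let ?pre = "p @ concat (map ((!) ws) pre) @ r"
  have "p @ concat (map ((!) ws) v) @ s = ?pre @ c' # (y' @ concat (map ((!) ws) xs) @ s)"
    unfolding d(2) using r by simp
  moreover have "p @ concat ws @ s = ?pre @ c # (x' @ concat (map ((!) ws) ys) @ s)"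
    by (subst ws, subst d(3)) (use r in simp)
  moreover have "length (p @ concat (map ((!) ws) v) @ s) = length (p @ concat ws @ s)"
    using len by simp
  moreover have "(c', c) \<in> less_than" using r(3) by simp
  ultimately show ?thesis unfolding lex_conv by blast
qed

section \<open>Linearisation of an identity\<close>

lemma lprod_append: "xs \<noteq> [] \<Longrightarrow> ys \<noteq> [] \<Longrightarrow> lprod (xs @ ys) = lprod xs * lprod ys"
proof (induction xs rule: lprod.induct)
  case (2 x)
  then show ?case by (cases ys) auto
qed (auto simp: mult.assoc)

lemma lprod_Cons: "xs \<noteq> [] \<Longrightarrow> lprod (x # xs) = x * lprod xs"
  by (cases xs) auto

lemma lprod_concat:
  assumes "[] \<notin> set xss" "xss \<noteq> []"
  shows "lprod (map lprod xss) = lprod (concat xss)"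
  using assms
proof (induction xss)
  case (Cons xs xss)
  show ?case
  proof (cases xss)
    case (Cons ys yss)
    then have "concat xss \<noteq> []" using Cons.prems by auto
    then show ?thesis using Cons.IH Cons.prems Cons by (auto simp: lprod_append)
  qed simp
qed simp

text \<open>Distributivity: picking a summand in every factor means picking a word \<open>t\<close>
  over \<open>S\<close> that \<open>c\<close> maps to \<open>v\<close>.\<close>

lemma lprod_substitute_sums:
  assumes "v \<noteq> []" "finite S"
  shows "lprod (map (\<lambda>i. \<Sum>j\<in>{j\<in>S. c j = i}. y j) v) =
    (\<Sum>t\<in>{t. set t \<subseteq> S \<and> map c t = v}. lprod (map y t))"
  using assms(1)
proof (induction v rule: list_nonempty_induct)
  case (single x)
  have eq: "{t. set t \<subseteq> S \<and> map c t = [x]} = (\<lambda>j. [j]) ` {j\<in>S. c j = x}" by auto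
  show ?case unfolding eq by (subst sum.reindex) (auto intro: inj_onI)
next
  case (cons x zs)
  let ?A = "{j\<in>S. c j = x}" and ?T = "{t. set t \<subseteq> S \<and> map c t = zs}"
  have eq: "{t. set t \<subseteq> S \<and> map c t = x # zs} = (\<lambda>(j, t). j # t) ` (?A \<times> ?T)"
    by (auto simp: map_eq_Cons_conv image_iff)
  have "(\<Sum>t\<in>{t. set t \<subseteq> S \<and> map c t = x # zs}. lprod (map y t))
      = (\<Sum>(j, t)\<in>?A \<times> ?T. lprod (map y (j # t)))"
    unfolding eq by (subst sum.reindex) (auto intro: inj_onI simp: case_prod_beta)
  also have "\<dots> = (\<Sum>(j, t)\<in>?A \<times> ?T. y j * lprod (map y t))"
  proof (intro sum.cong refl, clarify)
    fix j t assume "set t \<subseteq> S" "zs = map c t"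
    then have "map y t \<noteq> []" using cons.hyps by auto
    then show "lprod (map y (j # t)) = y j * lprod (map y t)" by (simp add: lprod_Cons)
  qed
  also have "\<dots> = (\<Sum>j\<in>?A. y j) * (\<Sum>t\<in>?T. lprod (map y t))"
    by (simp add: sum_product sum.cartesian_product)
  also have "\<dots> = lprod (map (\<lambda>i. \<Sum>j\<in>{j\<in>S. c j = i}. y j) (x # zs))"
    using cons by (simp add: lprod_Cons)
  finally show ?case by simp
qed

text \<open>Replaces the alternating signs of inclusion--exclusion by an induction on the support.\<close>

lemma sum_exact_support_zero:
  fixes g :: "'b \<Rightarrow> 'c::comm_monoid_add"
  assumes "finite T" "finite S"
    and zero: "\<And>R. R \<subseteq> S \<Longrightarrow> (\<Sum>t\<in>{t\<in>T. h t \<subseteq> R}. g t) = 0"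
  shows "(\<Sum>t\<in>{t\<in>T. h t = S}. g t) = 0"
  using assms(2,3)
proof (induction S rule: finite_psubset_induct)
  case (psubset S)
  let ?H = "\<lambda>R. \<Sum>t\<in>{t\<in>T. h t = R}. g t"
  have small: "?H R = 0" if "R \<subset> S" for R
    using psubset.IH[OF that] psubset.prems that by blast
  have "0 = (\<Sum>t\<in>{t\<in>T. h t \<subseteq> S}. g t)" using psubset.prems by simp
  also have "\<dots> = (\<Sum>R\<in>Pow S. \<Sum>t\<in>{t. t \<in> {t\<in>T. h t \<subseteq> S} \<and> h t = R}. g t)"
    using assms(1) psubset.hyps by (intro sum.group[symmetric]) auto
  also have "\<dots> = (\<Sum>R\<in>Pow S. ?H R)"
    by (intro sum.cong) auto
  also have "\<dots> = ?H S + (\<Sum>R\<in>Pow S - {S}. ?H R)"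
    using psubset.hyps by (intro sum.remove) auto
  also have "(\<Sum>R\<in>Pow S - {S}. ?H R) = 0"
    using small by (intro sum.neutral) blast
  finally show ?case by simp
qed

context assoc_algebra
begin

text \<open>In degree 0 the coefficient 1 would belong to the empty word, which an identity must not
  contain.\<close>

lemma admissible_degree_pos:
  assumes "admissible_identity f n"
  shows "n \<ge> 1"
proof (rule ccontr)
  assume "\<not> n \<ge> 1"
  then have "n = 0" by simp
  then have "Poly_Mapping.lookup f [] = 1" using assms unfolding admissible_identity_def
    by (metis length_0_conv)
  then have "[] \<in> Poly_Mapping.keys f" by (simp add: in_keys_iff)
  then show False using assms unfolding admissible_identity_def polynomial_identity_def by blast
qed

text \<open>Let \<open>w\<close> have coefficient 1. For variable \<open>i\<close> substitute the
  sum of those \<open>y j\<close> with \<open>j\<close> in \<open>S\<close> and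
  \<open>w ! j = i\<close>; this vanishes for every \<open>S\<close>, hence so does the part of the
  expansion that uses all \<open>n\<close> indices. There the identity arrangement has the
  coefficient of \<open>w\<close>.\<close>

lemma linearised_identity:
  assumes "admissible_identity f n"
  shows "lprod (map y [0..<n]) \<in>
    span {lprod (map y v) | v. distinct v \<and> set v = {..<n} \<and> v \<noteq> [0..<n]}"
proof -
  let ?K = "Poly_Mapping.keys f"
  obtain w where w: "length w = n" "Poly_Mapping.lookup f w = 1"
    using assms unfolding admissible_identity_def by blast
  have ident: "nc_eval f x = 0" for x
    using assms unfolding admissible_identity_def polynomial_identity_def by blast
  have keys: "v \<noteq> [] \<and> length v \<le> n" if "v \<in> ?K" for v
    using assms that unfolding admissible_identity_def polynomial_identity_def nc_degree_def
    by (metis Max_ge finite_imageI finite_keys imageI)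
  define c where "c = (!) w"
  define T where "T = {t. set t \<subseteq> {..<n} \<and> length t \<le> n}"
  define g where "g t = scale (Poly_Mapping.lookup f (map c t)) (lprod (map y t))" for t
  have finT: "finite T" unfolding T_def by (simp add: finite_lists_length_le)
  have zero: "(\<Sum>t\<in>{t\<in>T. set t \<subseteq> S}. g t) = 0" if "S \<subseteq> {..<n}" for S
  proof -
    have finS: "finite S" using that finite_subset by blast
    define TS where "TS = {t\<in>T. set t \<subseteq> S \<and> map c t \<in> ?K}"
    have TS: "{t. set t \<subseteq> S \<and> map c t = v} = {t. t \<in> TS \<and> map c t = v}" if "v \<in> ?K" for v
      using keys[OF that] that \<open>S \<subseteq> {..<n}\<close> unfolding TS_def T_def by auto
    have "0 = nc_eval f (\<lambda>i. \<Sum>j\<in>{j\<in>S. c j = i}. y j)" by (simp add: ident)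
    also have "\<dots> = (\<Sum>v\<in>?K. scale (Poly_Mapping.lookup f v)
        (\<Sum>t\<in>{t. set t \<subseteq> S \<and> map c t = v}. lprod (map y t)))"
      unfolding nc_eval_def using keys finS by (intro sum.cong) (auto simp: lprod_substitute_sums)
    also have "\<dots> = (\<Sum>v\<in>?K. \<Sum>t\<in>{t. t \<in> TS \<and> map c t = v}. g t)"
      by (intro sum.cong) (auto simp: scale_sum_right TS g_def intro!: sum.cong)
    also have "\<dots> = (\<Sum>t\<in>TS. g t)"
      using finT unfolding TS_def by (intro sum.group) auto
    \<comment> \<open>The added words have images outside the support of \<open>f\<close>, so their
      terms are zero.\<close>
    also have "\<dots> = (\<Sum>t\<in>{t\<in>T. set t \<subseteq> S}. g t)"
      using finT unfolding TS_def g_def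
      by (intro sum.mono_neutral_left) (auto simp: in_keys_iff)
    finally show ?thesis by simp
  qed
  \<comment> \<open>Length at most \<open>n\<close> with all \<open>n\<close> indices present:
    \<open>M\<close> consists of the permutations.\<close>
  define M where "M = {t\<in>T. set t = {..<n}}"
  have M0: "(\<Sum>t\<in>M. g t) = 0"
    unfolding M_def using sum_exact_support_zero[OF finT, where S = "{..<n}" and h = set and g = g] zero by simp
  have id: "[0..<n] \<in> M" unfolding M_def T_def by auto
  have "map c [0..<n] = w" unfolding c_def using w(1) by (metis map_nth)
  then have "g [0..<n] = lprod (map y [0..<n])" using w(2) by (simp add: g_def)
  moreover have "(\<Sum>t\<in>M. g t) = g [0..<n] + (\<Sum>t\<in>M - {[0..<n]}. g t)"
    using finT id by (intro sum.remove) (auto simp: M_def)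
  ultimately have "lprod (map y [0..<n]) = - (\<Sum>t\<in>M - {[0..<n]}. g t)"
    using M0 by (simp add: eq_neg_iff_add_eq_0)
  moreover have "(\<Sum>t\<in>M - {[0..<n]}. g t) \<in>
    span {lprod (map y v) | v. distinct v \<and> set v = {..<n} \<and> v \<noteq> [0..<n]}"
  proof (rule span_sum)
    fix t assume t: "t \<in> M - {[0..<n]}"
    then have "set t = {..<n}" "length t \<le> n" unfolding M_def T_def by auto
    moreover from this have "distinct t" using card_length[of t] by (intro card_distinct) simp
    ultimately show "g t \<in>
        span {lprod (map y v) | v. distinct v \<and> set v = {..<n} \<and> v \<noteq> [0..<n]}"
      unfolding g_def using t by (intro span_scale span_base) blast
  qed
  ultimately show ?thesis by (simp add: span_neg)
qed

section \<open>Reduction of all words to indivisible ones in the algebra\<close>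

lemma mult_left_span: "y \<in> span X \<Longrightarrow> x * y \<in> span ((*) x ` X)"
proof (induction rule: span_induct_alt)
  case (step c z y)
  have "x * (scale c z + y) = scale c (x * z) + x * y"
    by (simp add: distrib_left scale_mult_right)
  with step show ?case by (simp add: span_add span_scale span_base)
qed (simp add: span_zero)

lemma mult_right_span: "y \<in> span X \<Longrightarrow> y * x \<in> span ((\<lambda>z. z * x) ` X)"
proof (induction rule: span_induct_alt)
  case (step c z y)
  have "(scale c z + y) * x = scale c (z * x) + y * x"
    by (simp add: distrib_right scale_mult_left)
  with step show ?case by (simp add: span_add span_scale span_base)
qed (simp add: span_zero)

text \<open>The context may be empty on either side, and without a unit an empty product has no
  useful value; hence the case splits.\<close>

lemma lprod_span_in_word:
  assumes "lprod v \<in> span (lprod ` V)" "v \<noteq> []" "[] \<notin> V"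
  shows "lprod (p @ v @ s) \<in> span ((\<lambda>v. lprod (p @ v @ s)) ` V)"
proof -
  have ne: "x \<noteq> []" if "x \<in> V" for x using that assms(3) by blast
  have r: "lprod (v @ s) \<in> span ((\<lambda>v. lprod (v @ s)) ` V)"
  proof (cases "s = []")
    case False
    have "(\<lambda>z. z * lprod s) ` lprod ` V = (\<lambda>v. lprod (v @ s)) ` V"
      unfolding image_image using ne False by (intro image_cong) (auto simp: lprod_append)
    then show ?thesis using mult_right_span[OF assms(1), of "lprod s"] assms(2) False
      by (simp add: lprod_append)
  qed (use assms in simp)
  show ?thesis
  proof (cases "p = []")
    case False
    have "(*) (lprod p) ` (\<lambda>v. lprod (v @ s)) ` V = (\<lambda>v. lprod (p @ v @ s)) ` V"
      unfolding image_image using ne False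
      by (intro image_cong) (auto simp: lprod_append[of p])
    then show ?thesis using mult_left_span[OF r, of "lprod p"] assms(2) False
      by (simp add: lprod_append[of p])
  qed (use r in simp)
qed

text \<open>The linearised identity is applied to the values of the factors and multiplied by the
  outer parts \<open>p\<close> and \<open>s\<close>. Recording \<open>set v = set w\<close> keeps
  the letters among the generators when the reduction is repeated.\<close>

lemma divisible_word_reduces:
  assumes "admissible_identity f n" "divisible n w" "w \<noteq> []"
  shows "lprod (map a w) \<in> span {lprod (map a v) | v. (v, w) \<in> lex less_than \<and> set v = set w}"
proof -
  have "n \<ge> 1" using admissible_degree_pos assms(1) by blast
  with divisible_nonempty_factors[OF assms(2) _ assms(3)]
  obtain p ws s where w: "w = p @ concat ws @ s" "length ws = n" "sorted_wrt strictly_above ws"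
    "[] \<notin> set ws" by blast
  define P where "P = {v. distinct v \<and> set v = {..<n} \<and> v \<noteq> [0..<n]}"
  define C where "C v = concat (map ((!) ws) v)" for v
  have ne: "[] \<notin> set (map (\<lambda>i. map a (ws ! i)) v)" if "set v = {..<n}" for v
  proof
    assume "[] \<in> set (map (\<lambda>i. map a (ws ! i)) v)"
    then obtain i where i: "i \<in> set v" "ws ! i = []" by auto
    then have "i < length ws" using that w(2) by simp
    then show False using i(2) w(4) nth_mem by metis
  qed
  have eval: "lprod (map (\<lambda>i. lprod (map a (ws ! i))) v) = lprod (map a (C v))"
    if "set v = {..<n}" for v
  proof -
    have "0 \<in> set v" unfolding that using \<open>n \<ge> 1\<close> by simp
    then have "v \<noteq> []" by auto
    then have "lprod (map lprod (map (\<lambda>i. map a (ws ! i)) v)) =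
        lprod (concat (map (\<lambda>i. map a (ws ! i)) v))"
      using ne[OF that] by (intro lprod_concat) auto
    then show ?thesis by (simp add: C_def map_concat comp_def)
  qed
  have C_id: "C [0..<n] = concat ws" unfolding C_def using w(2) by (metis map_nth)
  have C_ne: "C v \<noteq> []" if "set v = {..<n}" for v
  proof -
    have "0 \<in> set v" unfolding that using \<open>n \<ge> 1\<close> by simp
    then have "v \<noteq> []" by auto
    then have "hd v \<in> set v" by simp
    then have "ws ! hd v \<noteq> []" using ne[OF that] by (auto simp: image_iff)
    then show ?thesis using \<open>hd v \<in> set v\<close> unfolding C_def by auto
  qed
  have set_upt: "set [0..<n] = {..<n}" by (simp add: atLeast0LessThan)
  have "lprod (map (\<lambda>i. lprod (map a (ws ! i))) [0..<n]) \<in>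
      span ((\<lambda>v. lprod (map (\<lambda>i. lprod (map a (ws ! i))) v)) ` P)"
    using linearised_identity[OF assms(1)] unfolding P_def setcompr_eq_image .
  also have "(\<lambda>v. lprod (map (\<lambda>i. lprod (map a (ws ! i))) v)) ` P = lprod ` (\<lambda>v. map a (C v)) ` P"
    unfolding image_image by (intro image_cong) (auto simp: eval P_def)
  finally have "lprod (map a (C [0..<n])) \<in> span (lprod ` (\<lambda>v. map a (C v)) ` P)"
    using eval[OF set_upt] by simp
  moreover have "[] \<notin> (\<lambda>v. map a (C v)) ` P" using C_ne unfolding P_def by auto
  moreover have "map a (C [0..<n]) \<noteq> []" using C_ne[OF set_upt] by simp
  ultimately have "lprod (map a p @ map a (C [0..<n]) @ map a s) \<in>
      span ((\<lambda>x. lprod (map a p @ x @ map a s)) ` (\<lambda>v. map a (C v)) ` P)"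
    by (intro lprod_span_in_word)
  then have "lprod (map a w) \<in> span ((\<lambda>v. lprod (map a (p @ C v @ s))) ` P)"
    unfolding w(1) C_id image_image by simp
  also have "\<dots> \<subseteq> span {lprod (map a v) | v. (v, w) \<in> lex less_than \<and> set v = set w}"
  proof (rule span_mono, rule subsetI)
    fix x assume "x \<in> (\<lambda>v. lprod (map a (p @ C v @ s))) ` P"
    then obtain v where v: "x = lprod (map a (p @ C v @ s))" "distinct v" "set v = {..<n}"
        "v \<noteq> [0..<n]" unfolding P_def by blast
    have "(p @ C v @ s, w) \<in> lex less_than"
      unfolding w(1) C_def using permuted_factors_smaller[OF w(3,2) v(2-4)] .
    moreover have "set (C v) = set (C [0..<n])" unfolding C_def by (simp add: v(3) atLeast0LessThan)
    then have "set (p @ C v @ s) = set w" unfolding w(1) C_id by simp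
    ultimately show "x \<in> {lprod (map a v) | v. (v, w) \<in> lex less_than \<and> set v = set w}"
      using v(1) by blast
  qed
  finally show ?thesis .
qed

text \<open>Repeated reduction terminates because \<open>lex less_than\<close> is
  well-founded.\<close>

lemma word_in_span_indivisible:
  fixes w :: "nat list"
  assumes "admissible_identity f n" "w \<noteq> []" "set w \<subseteq> L"
  shows "lprod (map a w) \<in> span {lprod (map a v) | v. v \<noteq> [] \<and> set v \<subseteq> L \<and> \<not> divisible n v}"
    (is "_ \<in> span ?I")
  using assms(2,3)
proof (induction w rule: wf_induct_rule[OF wf_lex[OF wf_less_than]])
  case (1 w)
  show ?case
  proof (cases "divisible n w")
    case True
    have "{lprod (map a v) | v. (v, w) \<in> lex less_than \<and> set v = set w} \<subseteq> span ?I"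
    proof
      fix x assume "x \<in> {lprod (map a v) | v. (v, w) \<in> lex less_than \<and> set v = set w}"
      then obtain v where v: "(v, w) \<in> lex less_than" "set v = set w" "x = lprod (map a v)"
        by blast
      have "v \<noteq> []" using 1(2) v(2) by auto
      moreover have "set v \<subseteq> L" using 1(3) v(2) by simp
      ultimately show "x \<in> span ?I" unfolding v(3) by (rule 1(1)[OF v(1)])
    qed
    then have "span {lprod (map a v) | v. (v, w) \<in> lex less_than \<and> set v = set w} \<subseteq> span ?I"
      by (simp add: span_minimal subspace_span)
    then show ?thesis using divisible_word_reduces[OF assms(1) True] 1 by blast
  next
    case False
    then show ?thesis using 1 by (intro span_base) blast
  qed
qed

text \<open>Word values together with an identity element, if there is one, are closed under
  products, so their span is a subalgebra containing the generators.\<close>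

lemma generated_by_words:
  assumes "generated_by (a ` L)"
  shows "span ({lprod (map a w) | w. w \<noteq> [] \<and> set w \<subseteq> L} \<union> {e. \<forall>x. e * x = x \<and> x * e = x}) = UNIV"
    (is "span (?W \<union> ?E) = UNIV")
proof -
  let ?B = "span (?W \<union> ?E)"
  have gens: "x * y \<in> ?W \<union> ?E" if "x \<in> ?W \<union> ?E" "y \<in> ?W \<union> ?E" for x y
  proof (cases "x \<in> ?W \<and> y \<in> ?W")
    case True
    then obtain v w where "x = lprod (map a v)" "y = lprod (map a w)" "v \<noteq> []" "w \<noteq> []"
      "set v \<subseteq> L" "set w \<subseteq> L" by blast
    then have "x * y = lprod (map a (v @ w))" "v @ w \<noteq> []" "set (v @ w) \<subseteq> L"
      by (auto simp: lprod_append)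
    then show ?thesis by blast
  next
    case False
    then have "x * y = y \<or> x * y = x" using that by auto
    then show ?thesis using that by auto
  qed
  have "x * y \<in> ?B" if "x \<in> ?B" "y \<in> ?B" for x y
  proof -
    have "z * y \<in> ?B" if "z \<in> ?W \<union> ?E" for z
    proof -
      have "(*) z ` (?W \<union> ?E) \<subseteq> ?W \<union> ?E" using gens that by blast
      then show ?thesis using mult_left_span[OF \<open>y \<in> ?B\<close>, of z] span_mono by blast
    qed
    then have "(\<lambda>z. z * y) ` (?W \<union> ?E) \<subseteq> ?B" by blast
    then have "span ((\<lambda>z. z * y) ` (?W \<union> ?E)) \<subseteq> ?B" by (simp add: span_minimal subspace_span)
    then show ?thesis using mult_right_span[OF \<open>x \<in> ?B\<close>, of y] by blast
  qed
  then have "subalgebra ?B" unfolding subalgebra_def using subspace_span by blast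
  moreover have "a ` L \<subseteq> ?W"
  proof
    fix x assume "x \<in> a ` L"
    then obtain i where "x = lprod (map a [i])" "i \<in> L" by auto
    then show "x \<in> ?W" by (metis (mono_tags, lifting) empty_set empty_subsetI insert_subset
      list.distinct(1) list.simps(15) mem_Collect_eq)
  qed
  then have "a ` L \<union> ?E \<subseteq> ?B" using span_superset[of "?W \<union> ?E"] by blast
  ultimately have "subalgebra hull (a ` L \<union> ?E) \<subseteq> ?B" by (intro hull_minimal)
  then show ?thesis using assms unfolding generated_by_def by blast
qed

text \<open>All short pieces have values in the finite set \<open>D\<close>, all others are powers
  of words of length below \<open>n\<close>. The total number of pieces is already at most the
  height, so it also bounds the number of factors outside \<open>D\<close>.\<close>

lemma essentially_spanned_words:
  assumes "l \<ge> 1" "generated_by (a ` {..<l})" "admissible_identity f n"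
  shows "essentially_spanned (words_below a l n) (3 * (2 * (l + 1) ^ (n - 1) * (n - 1) + 1))"
proof -
  let ?h = "3 * (2 * (l + 1) ^ (n - 1) * (n - 1) + 1)" and ?N = "power_bound n l + n"
  define E where "E = {e :: 'a. \<forall>x. e * x = x \<and> x * e = x}"
  define D where "D = (\<lambda>v. lprod (map a v)) ` {v. set v \<subseteq> {..<l} \<and> length v \<le> ?N} \<union> E"
  define G where "G = {lprod ts | ts. ts \<noteq> [] \<and> length ts \<le> 2 * ?h + 1 \<and>
    (\<forall>t\<in>set ts. t \<in> D \<or> (\<exists>y\<in>words_below a l n. \<exists>k\<ge>1. t = pos_power y k)) \<and>
    card {i. i < length ts \<and> ts ! i \<notin> D} \<le> ?h}"
  \<comment> \<open>An identity element is unique, so adding \<open>E\<close> keeps \<open>D\<close>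
    finite.\<close>
  have "e = e'" if "e \<in> E" "e' \<in> E" for e e'
  proof -
    have "e * e' = e'" "e * e' = e" using that unfolding E_def by blast+
    then show ?thesis by metis
  qed
  then have "E \<subseteq> {SOME e. e \<in> E}" by (metis singletonI someI subsetI)
  then have "finite E" by (rule finite_subset) simp
  then have finD: "finite D" unfolding D_def by (simp add: finite_lists_length_le)
  have n: "n \<ge> 1" using admissible_degree_pos assms(3) by blast
  have card: "card {i. i < length ts \<and> ts ! i \<notin> D} \<le> length ts" for ts
    using card_mono[of "{..<length ts}" "{i. i < length ts \<and> ts ! i \<notin> D}"] by fastforce
  have E: "E \<subseteq> G"
  proof
    fix e assume "e \<in> E"
    then have "e \<in> D" unfolding D_def by blast
    moreover have "card {i. i < length [e] \<and> [e] ! i \<notin> D} \<le> ?h"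
      by (rule order_trans[OF card]) simp
    ultimately show "e \<in> G" unfolding G_def
      by (intro CollectI exI[of _ "[e]"] conjI) simp_all
  qed
  have W: "lprod (map a w) \<in> G" if w: "w \<noteq> []" "set w \<subseteq> {..<l}" "\<not> divisible n w" for w
  proof -
    obtain ws where ws: "w = concat ws" "length ws \<le> ?h"
      "\<forall>v\<in>set ws. length v \<le> ?N \<or> (\<exists>u k. v = wpow u k \<and> u \<noteq> [] \<and> length u < n \<and> 1 \<le> k)"
      using indivisible_word_pieces[OF n assms(1) w(2,3)] by blast
    \<comment> \<open>Empty pieces are dropped, since their junk value 0 would annihilate the
      product.\<close>
    define vs where "vs = filter (\<lambda>v. v \<noteq> []) ws"
    define ts where "ts = map (\<lambda>v. lprod (map a v)) vs"
    have vs: "w = concat vs" "[] \<notin> set vs" "set vs \<subseteq> set ws"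
    proof -
      have "concat (filter (\<lambda>v. v \<noteq> []) ws) = concat ws" by (induction ws) auto
      then show "w = concat vs" unfolding vs_def ws(1) by simp
    qed (auto simp: vs_def)
    have "vs \<noteq> []" using vs(1) w(1) by auto
    have len: "length ts \<le> ?h" using ws(2) unfolding ts_def vs_def
      by (metis (no_types, lifting) length_filter_le length_map order_trans)
    have "lprod ts = lprod (map lprod (map (map a) vs))" unfolding ts_def by (simp add: comp_def)
    also have "\<dots> = lprod (map a w)"
      using vs \<open>vs \<noteq> []\<close> by (subst lprod_concat) (auto simp: map_concat)
    finally have val: "lprod (map a w) = lprod ts" by simp
    have "t \<in> D \<or> (\<exists>y\<in>words_below a l n. \<exists>k\<ge>1. t = pos_power y k)" if t: "t \<in> set ts" for t
    proof -
      obtain v where v: "v \<in> set vs" "t = lprod (map a v)" using t unfolding ts_def by auto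
      have letters: "set v \<subseteq> {..<l}" using w(2) vs(1) v(1) by auto
      consider "length v \<le> ?N" | u k where "v = wpow u k" "u \<noteq> []" "length u < n" "1 \<le> k"
        using ws(3) vs(3) v(1) by blast
      then show ?thesis
      proof cases
        case 1
        then have "t \<in> D" using letters v(2) unfolding D_def by blast
        then show ?thesis ..
      next
        case 2
        then have "set u \<subseteq> {..<l}" using letters by auto
        then have "lprod (map a u) \<in> words_below a l n"
          using 2 unfolding words_below_def by blast
        moreover have "t = lprod (concat (replicate k (map a u)))"
          unfolding v(2) 2(1) by (simp add: map_concat)
        then have "t = lprod (map lprod (replicate k (map a u)))"
          using 2 by (subst lprod_concat) auto
        then have "t = pos_power (lprod (map a u)) k" unfolding pos_power_def by simp
        ultimately show ?thesis using 2(4) by blast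
      qed
    qed
    moreover have "ts \<noteq> []" using \<open>vs \<noteq> []\<close> unfolding ts_def by simp
    moreover have "card {i. i < length ts \<and> ts ! i \<notin> D} \<le> ?h" using card len by (rule order_trans)
    moreover have "length ts \<le> 2 * ?h + 1" using len by linarith
    ultimately show ?thesis unfolding G_def val by blast
  qed
  have "{lprod (map a w) | w. w \<noteq> [] \<and> set w \<subseteq> {..<l}} \<subseteq> span G"
  proof
    fix x assume "x \<in> {lprod (map a w) | w. w \<noteq> [] \<and> set w \<subseteq> {..<l}}"
    then obtain w where "x = lprod (map a w)" "w \<noteq> []" "set w \<subseteq> {..<l}" by blast
    moreover have "{lprod (map a v) | v. v \<noteq> [] \<and> set v \<subseteq> {..<l} \<and> \<not> divisible n v} \<subseteq> G"
      using W by blast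
    ultimately show "x \<in> span G"
      using word_in_span_indivisible[OF assms(3)] span_mono by blast
  qed
  moreover have "E \<subseteq> span G" using E span_superset by blast
  ultimately have "span ({lprod (map a w) | w. w \<noteq> [] \<and> set w \<subseteq> {..<l}} \<union> E) \<subseteq> span G"
    by (intro span_minimal subspace_span) blast
  then have "span G = UNIV" using generated_by_words[OF assms(2)] unfolding E_def by blast
  with finD show ?thesis unfolding essentially_spanned_def G_def by blast
qed

end

text \<open>With \<open>n = m + 1\<close> and \<open>X = (l + 1) ^ m\<close> the left side is
  \<open>6 X m + 3\<close>, which is below \<open>8 X n\<close>; the remaining factor
  \<open>(l + 1) * n ^ 5 * l\<close> is at least 1.\<close>

lemma spanning_height_less_Upsilon:
  assumes "l \<ge> 1" "n \<ge> 1"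
  shows "3 * (2 * (l + 1) ^ (n - 1) * (n - 1) + 1) < Upsilon n l"
proof -
  obtain m where m: "n = Suc m" using assms(2) by (cases n) auto
  define X where "X = (l + 1) ^ m"
  have X: "1 \<le> X" unfolding X_def by simp
  have one_le: "1 \<le> (l + 1) * n ^ 5 * l" using assms by (simp add: Suc_le_eq)
  have "3 * (2 * X * m + 1) < 8 * X * n"
    using X m by (simp add: algebra_simps)
  also have "8 * X * n \<le> (8 * X * n) * ((l + 1) * n ^ 5 * l)"
    using mult_le_mono2[OF one_le, of "8 * X * n"] by simp
  also have "\<dots> = Upsilon n l"
  proof -
    have "(l + 1) ^ n = X * (l + 1)" unfolding X_def m by simp
    moreover have "n ^ 6 = n * n ^ 5" by (simp flip: power_Suc)
    ultimately show ?thesis unfolding Upsilon_def by (simp only: mult.assoc mult.commute mult.left_commute)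
  qed
  finally show ?thesis unfolding X_def m by simp
qed

theorem mainTheorem3:
  fixes scale :: "'k::comm_ring_1 \<Rightarrow> 'a::ring \<Rightarrow> 'a"
    and a :: "nat \<Rightarrow> 'a" and l n :: nat and f :: "'k nc_poly"
  assumes "assoc_algebra scale"
    and "l \<ge> 1"
    and "assoc_algebra.generated_by scale (a ` {..<l})"
    and "assoc_algebra.admissible_identity scale f n"
  shows "assoc_algebra.essential_height scale (words_below a l n) < enat (Upsilon n l)"
proof -
  interpret assoc_algebra scale by (rule assms(1))
  let ?h = "3 * (2 * (l + 1) ^ (n - 1) * (n - 1) + 1)"
  have "essential_height (words_below a l n) \<le> enat ?h"
    unfolding essential_height_def
    using essentially_spanned_words[OF assms(2-4)] by (intro INF_lower) simp
  also have "\<dots> < enat (Upsilon n l)"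
    using spanning_height_less_Upsilon[OF assms(2) admissible_degree_pos[OF assms(4)]] by simp
  finally show ?thesis .
qed

end
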